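(* Let $n\ge 2$ be an integer and consider the linear differential equation $$\Big(\sum_{k=0}^{n}\alpha_k r^k\Big)y''(r)+\Big(\sum_{k=0}^{n-1}\beta_k r^k\Big)y'(r)-\Big(\sum_{k=0}^{n-2}\tau_k r^k\Big)y(r)=0,$$ with constant coefficients $\alpha_k,\beta_k,\tau_k$, where the leading coefficient $\tau_{n-2}$ is nonzero and at least one of $\alpha_n$ and $\beta_{n-1}$ is nonzero. A necessary condition for this equation to have a polynomial solution of degree $m$ is $$\tau_{n-2}=\alpha_n\,m(m-1)+\beta_{n-1}\,m .$$
   Context: The coefficients $\alpha_k,\beta_k,\tau_k$ are constants (real or complex numbers), and $m$ is a nonnegative integer. A polynomial solution of degree $m$ is a solution $y(r)=\sum_{i=0}^{m}\mathcal{C}_i r^i$ with constants $\mathcal{C}_i$ and $\mathcal{C}_m\ne 0$. *)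

theory Defs
  imports "HOL-Analysis.Analysis"
begin

(* The variable r ranges over a set S, with derivatives taken within S.  This covers real
   equations on real intervals and, for complex coefficients, both a complex variable on an
   open set and a real variable (S an interval contained in \<real>).  The functions y1 and y2
   are y' and y'' on S; they are uniquely determined there when S has no isolated points. *)
definition ode_solution_on ::
  "nat \<Rightarrow> (nat \<Rightarrow> 'a::real_normed_field) \<Rightarrow> (nat \<Rightarrow> 'a) \<Rightarrow> (nat \<Rightarrow> 'a) \<Rightarrow> 'a set \<Rightarrow> ('a \<Rightarrow> 'a) \<Rightarrow> bool"
where
  "ode_solution_on n \<alpha> \<beta> \<tau> S y \<longleftrightarrow>
     (\<exists>y1 y2. \<forall>r\<in>S.
        (y has_field_derivative y1 r) (at r within S) \<and>
        (y1 has_field_derivative y2 r) (at r within S) \<and>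
        (\<Sum>k\<le>n. \<alpha> k * r ^ k) * y2 r + (\<Sum>k\<le>n - 1. \<beta> k * r ^ k) * y1 r
          - (\<Sum>k\<le>n - 2. \<tau> k * r ^ k) * y r = 0)"

definition polynomial_solution_on ::
  "nat \<Rightarrow> (nat \<Rightarrow> 'a::real_normed_field) \<Rightarrow> (nat \<Rightarrow> 'a) \<Rightarrow> (nat \<Rightarrow> 'a) \<Rightarrow> 'a set \<Rightarrow> nat \<Rightarrow> ('a \<Rightarrow> 'a) \<Rightarrow> bool"
where
  "polynomial_solution_on n \<alpha> \<beta> \<tau> S m y \<longleftrightarrow>
     ode_solution_on n \<alpha> \<beta> \<tau> S y \<and>
     (\<exists>C. C m \<noteq> 0 \<and> (\<forall>r\<in>S. y r = (\<Sum>i\<le>m. C i * r ^ i)))"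

end

theory Submission
  imports Defs "HOL-Computational_Algebra.Polynomial"
begin

text \<open>
  Substituting \<open>y = C\<^sub>0 + \<dots> + C\<^sub>m r\<^sup>m\<close> makes the left-hand side a polynomial of formal degree
  at most \<open>m + n - 2\<close>, in which \<open>r\<^bsup>m + n - 2\<^esup>\<close> arises only from products of top terms. Its coefficient
  is \<open>(\<alpha>\<^sub>n m (m - 1) + \<beta>\<^sub>n\<^sub>-\<^sub>1 m - \<tau>\<^sub>n\<^sub>-\<^sub>2) C\<^sub>m\<close>, so the claim follows once this polynomial is known to be
  zero, because \<open>C\<^sub>m \<noteq> 0\<close>.

  The equation holds only on \<open>S\<close>, with derivatives taken within \<open>S\<close>. As every point of \<open>S\<close> is a limit
  point, these derivatives are unique and so agree on \<open>S\<close> with the formal derivatives of the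
  polynomial (\<open>has_field_derivative_eq_poly_pderiv\<close>). For the same reason \<open>S\<close> is infinite, and a
  polynomial with infinitely many roots is zero (\<open>poly_eq_0_if_vanishes_on_infinite\<close>).

  For \<open>m < 2\<close> the formal degree \<open>m - 2\<close> of \<open>y''\<close> is negative. Multiplying the equation by \<open>r\<^sup>2\<close>
  avoids a case distinction: the second factors become \<open>r\<^sup>2 y''\<close>, \<open>r y'\<close> and \<open>y\<close>, all of degree
  at most \<open>m\<close>, the first factors have degree at most \<open>n\<close>, and the coefficients at \<open>n + m\<close> are
  compared (\<open>coeff_mult_at_degree_bounds\<close>).
\<close>

lemma has_field_derivative_eq_poly_pderiv:
  fixes p :: "'a::real_normed_field poly"
  assumes "(f has_field_derivative D) (at r within S)"
    and "\<And>x. x \<in> S \<Longrightarrow> f x = poly p x" and "r \<in> S" and "r islimpt S"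
  shows "D = poly (pderiv p) r"
proof (rule has_field_derivative_unique)
  show "(poly p has_field_derivative D) (at r within S)"
    using has_field_derivative_transform_within[OF assms(1) zero_less_one assms(3)] assms(2)
    by blast
  show "(poly p has_field_derivative poly (pderiv p) r) (at r within S)"
    by (rule has_field_derivative_at_within) (rule poly_DERIV)
  show "at r within S \<noteq> bot"
    using assms(4) trivial_limit_within by blast
qed

lemma poly_eq_0_if_vanishes_on_infinite:
  fixes p :: "'a::idom poly"
  assumes "infinite S" and "\<And>x. x \<in> S \<Longrightarrow> poly p x = 0"
  shows "p = 0"
  using assms poly_roots_finite[of p] by (metis (mono_tags) finite_subset mem_Collect_eq subsetI)

text \<open>
  Only the product of the two top terms reaches the index \<open>n + m\<close>. The bounds need not be the exact
  degrees, since top coefficients such as \<open>\<alpha> n\<close> may vanish.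
\<close>

lemma coeff_mult_at_degree_bounds:
  fixes p q :: "'a::comm_semiring_1 poly"
  assumes "degree p \<le> n" and "degree q \<le> m"
  shows "coeff (p * q) (n + m) = coeff p n * coeff q m"
proof -
  have off_top: "coeff p i * coeff q (n + m - i) = 0" if "i \<noteq> n" for i
  proof (cases "n < i")
    case True
    then show ?thesis using assms(1) by (simp add: coeff_eq_0)
  next
    case False
    then have "m < n + m - i" using that by simp
    then show ?thesis using assms(2) by (simp add: coeff_eq_0)
  qed
  have "coeff (p * q) (n + m) = (\<Sum>i\<le>n + m. coeff p i * coeff q (n + m - i))"
    by (rule coeff_mult)
  also have "\<dots> = (\<Sum>i\<in>{n}. coeff p i * coeff q (n + m - i))"
    by (rule sum.mono_neutral_right) (auto simp: off_top)
  finally show ?thesis by simp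
qed

lemma poly_sum_monom:
  fixes x :: "'a::comm_semiring_1"
  shows "poly (\<Sum>i\<le>d. monom (c i) i) x = (\<Sum>i\<le>d. c i * x ^ i)"
  by (simp add: poly_sum poly_monom)

lemma degree_sum_monom_le: "degree (\<Sum>i\<le>d. monom (c i) i) \<le> d"
  by (rule degree_sum_le) (auto intro: order_trans[OF degree_monom_le])

text \<open>
  Monomials are eigenvectors of the Euler operators \<open>r d/dr\<close> and \<open>r\<^sup>2 d\<^sup>2/dr\<^sup>2\<close>, so that no index is
  shifted. For exponents below the order of the derivative the eigenvalue is zero.
\<close>

lemma coeff_x_pderiv:
  fixes p :: "'a::idom poly"
  shows "coeff (pCons 0 (pderiv p)) k = of_nat k * coeff p k"
  by (cases k) (simp_all add: coeff_pderiv)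

lemma coeff_x2_pderiv2:
  fixes p :: "'a::idom poly"
  shows "coeff (pCons 0 (pCons 0 (pderiv (pderiv p)))) k = of_nat k * (of_nat k - 1) * coeff p k"
proof (cases k)
  case (Suc j)
  then show ?thesis by (cases j) (simp_all add: coeff_pderiv algebra_simps)
qed simp

lemma top_coeff_if_polynomial_ode:
  fixes A B T p :: "'a::idom poly"
  assumes eq: "A * pderiv (pderiv p) + B * pderiv p - T * p = 0"
    and "n \<ge> 2"
    and A: "degree A \<le> n" and B: "degree B \<le> n - 1" and T: "degree T \<le> n - 2"
    and p: "degree p \<le> m" "coeff p m \<noteq> 0"
  shows "coeff T (n - 2) = coeff A n * of_nat m * (of_nat m - 1) + coeff B (n - 1) * of_nat m"
proof -
  define p1 p2 where "p1 = pCons 0 (pderiv p)" and "p2 = pCons 0 (pCons 0 (pderiv (pderiv p)))"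
  have p1: "degree p1 \<le> m" and p2: "degree p2 \<le> m"
    unfolding p1_def p2_def using p(1)
    by (auto intro!: degree_le simp: coeff_x_pderiv coeff_x2_pderiv2 coeff_eq_0
        simp del: degree_pCons_eq_if)
  have B': "degree (pCons 0 B) \<le> n" and T': "degree (pCons 0 (pCons 0 T)) \<le> n"
    using B T \<open>n \<ge> 2\<close> degree_pCons_le[of 0 B] degree_pCons_le[of 0 T]
      degree_pCons_le[of 0 "pCons 0 T"] by linarith+
  obtain k where n: "n = Suc (Suc k)"
    using \<open>n \<ge> 2\<close> by (metis add_2_eq_Suc le_Suc_ex)
  have "A * p2 + pCons 0 B * p1 - pCons 0 (pCons 0 T) * p
      = pCons 0 (pCons 0 (A * pderiv (pderiv p) + B * pderiv p - T * p))"
    by (simp add: p1_def p2_def)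
  then have "coeff (A * p2 + pCons 0 B * p1 - pCons 0 (pCons 0 T) * p) (n + m) = 0"
    by (simp only: eq pCons_0_0 coeff_0)
  then have "(coeff A n * of_nat m * (of_nat m - 1) + coeff B (n - 1) * of_nat m
      - coeff T (n - 2)) * coeff p m = 0"
    unfolding coeff_add coeff_diff coeff_mult_at_degree_bounds[OF A p2]
      coeff_mult_at_degree_bounds[OF B' p1] coeff_mult_at_degree_bounds[OF T' p(1)]
    unfolding p1_def p2_def coeff_x_pderiv coeff_x2_pderiv2
    by (simp add: n algebra_simps)
  with p(2) show ?thesis by simp
qed

theorem theorem2p1:
  fixes \<alpha> \<beta> \<tau> :: "nat \<Rightarrow> 'a::real_normed_field" and S :: "'a set" and n m :: nat
  assumes "n \<ge> 2"
    and "\<tau> (n - 2) \<noteq> 0"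
    and "\<alpha> n \<noteq> 0 \<or> \<beta> (n - 1) \<noteq> 0"
    and "S \<noteq> {}" and "\<forall>r\<in>S. r islimpt S"
    and "\<exists>y. polynomial_solution_on n \<alpha> \<beta> \<tau> S m y"
  shows "\<tau> (n - 2) = \<alpha> n * of_nat m * (of_nat m - 1) + \<beta> (n - 1) * of_nat m"
proof -
  obtain y y1 y2 C where Cm: "C m \<noteq> 0"
    and y: "\<And>r. r \<in> S \<Longrightarrow> y r = (\<Sum>i\<le>m. C i * r ^ i)"
    and y1: "\<And>r. r \<in> S \<Longrightarrow> (y has_field_derivative y1 r) (at r within S)"
    and y2: "\<And>r. r \<in> S \<Longrightarrow> (y1 has_field_derivative y2 r) (at r within S)"
    and ode: "\<And>r. r \<in> S \<Longrightarrow> (\<Sum>k\<le>n. \<alpha> k * r ^ k) * y2 r + (\<Sum>k\<le>n - 1. \<beta> k * r ^ k) * y1 r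
          - (\<Sum>k\<le>n - 2. \<tau> k * r ^ k) * y r = 0"
    using assms(6) unfolding polynomial_solution_on_def ode_solution_on_def by blast
  define p where "p = (\<Sum>i\<le>m. monom (C i) i)"
  define A where "A = (\<Sum>i\<le>n. monom (\<alpha> i) i)"
  define B where "B = (\<Sum>i\<le>n - 1. monom (\<beta> i) i)"
  define T where "T = (\<Sum>i\<le>n - 2. monom (\<tau> i) i)"
  have y_poly: "y r = poly p r" if "r \<in> S" for r
    using y[OF that] by (simp add: p_def poly_sum_monom)
  have y1_poly: "y1 r = poly (pderiv p) r" if "r \<in> S" for r
    using has_field_derivative_eq_poly_pderiv[OF y1 y_poly] assms(5) that by blast
  have y2_poly: "y2 r = poly (pderiv (pderiv p)) r" if "r \<in> S" for r
    using has_field_derivative_eq_poly_pderiv[OF y2 y1_poly] assms(5) that by blast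
  have "infinite S"
    using assms(4,5) islimpt_finite by blast
  then have "A * pderiv (pderiv p) + B * pderiv p - T * p = 0"
  proof (rule poly_eq_0_if_vanishes_on_infinite)
    show "poly (A * pderiv (pderiv p) + B * pderiv p - T * p) r = 0" if "r \<in> S" for r
      using ode[OF that] y_poly[OF that] y1_poly[OF that] y2_poly[OF that]
      by (simp add: A_def B_def T_def poly_sum_monom)
  qed
  from top_coeff_if_polynomial_ode[OF this assms(1), of m] Cm
  show ?thesis
    by (simp add: A_def B_def T_def p_def degree_sum_monom_le coeff_sum_monom)
qed

end
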